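(* Fix real numbers $p_0$, $\sigma_v>0$ and $\sigma_u>0$. For $\sigma_\varepsilon\ge 0$ let $(\beta,\lambda)=(\beta(\sigma_\varepsilon),\lambda(\sigma_\varepsilon))$ be the unique linear equilibrium of the privacy-noisy Kyle model (defined in the context). This equilibrium satisfies: (1) $\partial\lambda/\partial\sigma_\varepsilon<0$: the price-impact coefficient $\lambda$ strictly decreases as the privacy noise $\sigma_\varepsilon$ increases. (2) $\partial\beta/\partial\sigma_\varepsilon>0$: the informed-trader strategy intensifies (the coefficient $\beta$ increases) as the privacy noise $\sigma_\varepsilon$ increases. (3) (Half-revealing identity.) $\lambda\beta=1/2$ for all $\sigma_\varepsilon\ge 0$.
   Context: Model. On a probability space there are independent Gaussian random variables $v\sim N(p_0,\sigma_v^2)$ (asset value), $u\sim N(0,\sigma_u^2)$ (noise-trader flow) and $\varepsilon\sim N(0,\sigma_\varepsilon^2)$ (privacy noise), with $\sigma_v>0$, $\sigma_u>0$, $\sigma_\varepsilon\ge 0$, where $u$ is independent of $v$ and $\varepsilon$ is independent of $(v,u)$; if $\sigma_\varepsilon=0$ then $\varepsilon=0$ almost surely. An informed trader observes $v$ and submits an order $x$. The market maker observes only $\tilde y=x+u+\varepsilon$ and sets a price $p(\tilde y)$. Linear equilibrium. A linear equilibrium is a pair $(\beta,\lambda)\in\mathbb{R}_{>0}^2$, with strategy $x=\beta(v-p_0)$ and pricing rule $p(\tilde y)=p_0+\lambda\tilde y$, such that: (a) with $\tilde y=\beta(v-p_0)+u+\varepsilon$, $p_0+\lambda\tilde y=\mathbb{E}[v\mid\tilde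 y]$; (b) given $\lambda$, the order $x=\beta(v-p_0)$ maximizes over $x\in\mathbb{R}$ the informed trader's expected profit $\mathbb{E}[(v-p_0-\lambda(x+u+\varepsilon))\,x\mid v]$. For every $\sigma_\varepsilon\ge 0$ the model has a unique linear equilibrium, namely $\lambda=\sigma_v/(2\sqrt{\sigma_u^2+\sigma_\varepsilon^2})$, $\beta=\sqrt{\sigma_u^2+\sigma_\varepsilon^2}/\sigma_v$.
   Formalization: The strict derivative signs in (1) and (2) are stated for σ_ε > 0 only, since both derivatives vanish at σ_ε = 0; strict monotonicity of λ and β is stated on all of σ_ε ≥ 0. *)

theory Defs
  imports "HOL-Probability.Probability"
begin

(* For s = 0 the library's normal density is not a probability density; N(m,0) is the point mass
   at m, i.e. the variable is almost surely equal to m. *)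
definition gaussian_rv :: "'a measure \<Rightarrow> ('a \<Rightarrow> real) \<Rightarrow> real \<Rightarrow> real \<Rightarrow> bool" where
  "gaussian_rv M X m s \<longleftrightarrow>
     (if s = 0 then X \<in> borel_measurable M \<and> (AE \<omega> in M. X \<omega> = m)
      else distributed M lborel X (normal_density m s))"

definition cond_exp_given :: "'a measure \<Rightarrow> ('a \<Rightarrow> real) \<Rightarrow> ('a \<Rightarrow> real) \<Rightarrow> 'a \<Rightarrow> real" where
  "cond_exp_given M Y X = real_cond_exp M (vimage_algebra (space M) Y borel) X"

(* v: asset value, u: noise-trader flow, e: privacy noise;
   sv, su, se: their standard deviations. Independence of e and the pair (v, u) is independence of
   the generated sigma-algebras, because indep_var needs both variables to have the same type. *)
definition kyle_model ::
  "'a measure \<Rightarrow> ('a \<Rightarrow> real) \<Rightarrow> ('a \<Rightarrow> real) \<Rightarrow> ('a \<Rightarrow> real) \<Rightarrow> real \<Rightarrow> real \<Rightarrow> real \<Rightarrow> real \<Rightarrow> bool"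
where
  "kyle_model M v u e p0 sv su se \<longleftrightarrow>
     prob_space M \<and> sv > 0 \<and> su > 0 \<and> se \<ge> 0 \<and>
     gaussian_rv M v p0 sv \<and> gaussian_rv M u 0 su \<and> gaussian_rv M e 0 se \<and>
     prob_space.indep_var M borel u borel v \<and>
     prob_space.indep_set M
       (sets (vimage_algebra (space M) e borel))
       (sets (vimage_algebra (space M) (\<lambda>\<omega>. (v \<omega>, u \<omega>)) (borel \<Otimes>\<^sub>M borel)))"

definition noisy_flow :: "('a \<Rightarrow> real) \<Rightarrow> ('a \<Rightarrow> real) \<Rightarrow> ('a \<Rightarrow> real) \<Rightarrow> 'a \<Rightarrow> real" where
  "noisy_flow x u e = (\<lambda>\<omega>. x \<omega> + u \<omega> + e \<omega>)"

definition profit ::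
  "('a \<Rightarrow> real) \<Rightarrow> ('a \<Rightarrow> real) \<Rightarrow> ('a \<Rightarrow> real) \<Rightarrow> real \<Rightarrow> real \<Rightarrow> ('a \<Rightarrow> real) \<Rightarrow> 'a \<Rightarrow> real" where
  "profit v u e p0 l x = (\<lambda>\<omega>. (v \<omega> - p0 - l * noisy_flow x u e \<omega>) * x \<omega>)"

(* In the optimality condition the quantifier over the competing orders y stands outside "almost
   everywhere": a conditional expectation is determined only up to a null set, which may depend
   on y. *)
definition linear_equilibrium ::
  "'a measure \<Rightarrow> ('a \<Rightarrow> real) \<Rightarrow> ('a \<Rightarrow> real) \<Rightarrow> ('a \<Rightarrow> real) \<Rightarrow> real \<Rightarrow> real \<Rightarrow> real \<Rightarrow> bool"
where
  "linear_equilibrium M v u e p0 b l \<longleftrightarrow>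
     b > 0 \<and> l > 0 \<and>
     (let x = (\<lambda>\<omega>. b * (v \<omega> - p0)) in
       (AE \<omega> in M. p0 + l * noisy_flow x u e \<omega> = cond_exp_given M (noisy_flow x u e) v \<omega>) \<and>
       (\<forall>y::real. AE \<omega> in M.
          cond_exp_given M v (profit v u e p0 l (\<lambda>_. y)) \<omega>
            \<le> cond_exp_given M v (profit v u e p0 l x) \<omega>))"

end

(* Only two moment identities are extracted from an equilibrium. Integrating the pricing condition
   (a) against the flow y gives l E[y^2] = E[(v - p0) y], that is l (b^2 sv^2 + s^2) = b sv^2 with
   s^2 = su^2 + se^2. The optimality condition (b) forces the first-order condition
   (v - p0) - l E[u + e | v] = 2 l b (v - p0), and integrating it against v - p0, which is
   uncorrelated with u + e, gives 2 l b = 1. The two equations determine b and l. *)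

theory Submission
  imports Defs
begin

section \<open>Generated sigma-algebras and independence\<close>

text \<open>Gives access to the laws of \<open>real_cond_exp\<close>, which live in the locale
  \<open>sigma_finite_subalgebra\<close>. Measurability of \<open>X\<close> makes the generated
  sigma-algebra a part of \<open>sets M\<close>, and a finite measure stays finite on it.\<close>

lemma (in prob_space) sigma_finite_subalgebra_vimage:
  assumes "X \<in> measurable M N"
  shows "sigma_finite_subalgebra M (vimage_algebra (space M) X N)"
proof (rule finite_measure_subalgebra_is_sigma_finite)
  show "finite_measure_subalgebra M (vimage_algebra (space M) X N)"
  proof
    have "sets (vimage_algebra (space M) X N) \<subseteq> sets M"
      unfolding sets_vimage_algebra
      using measurable_sets[OF assms] by (intro sets.sigma_sets_subset) auto
    then show "subalgebra M (vimage_algebra (space M) X N)"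
      by (simp add: subalgebra_def)
  qed
qed

text \<open>The sigma-algebra generated by \<open>f\<close> after \<open>Z\<close> lies inside the
  one generated by \<open>Z\<close>, and independence passes to smaller families of events. With
  projections for \<open>f\<close>, this extracts independence of \<open>e\<close> from
  \<open>v\<close> and from \<open>u\<close> out of independence from the pair.\<close>

lemma (in prob_space) indep_var_compose_right_vimage:
  assumes indep: "indep_set (sets (vimage_algebra (space M) X S)) (sets (vimage_algebra (space M) Z T))"
    and X: "X \<in> measurable M S" and Z: "Z \<in> measurable M T" and f: "f \<in> measurable T N"
  shows "indep_var S X N (\<lambda>\<omega>. f (Z \<omega>))"
proof -
  have "sets (vimage_algebra (space M) (\<lambda>\<omega>. f (Z \<omega>)) N) \<subseteq> sets (vimage_algebra (space M) Z T)"
    unfolding sets_vimage_algebra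
  proof (rule sigma_sets_mono, safe)
    fix A assume "A \<in> sets N"
    then have "f -` A \<inter> space T \<in> sets T"
      using f by (rule measurable_sets[rotated])
    then have "Z -` (f -` A \<inter> space T) \<inter> space M \<in> sets (vimage_algebra (space M) Z T)"
      by (rule in_vimage_algebra)
    moreover have "Z -` (f -` A \<inter> space T) \<inter> space M = (\<lambda>\<omega>. f (Z \<omega>)) -` A \<inter> space M"
      using measurable_space[OF Z] by auto
    ultimately show "(\<lambda>\<omega>. f (Z \<omega>)) -` A \<inter> space M
        \<in> sigma_sets (space M) {Z -` A \<inter> space M |A. A \<in> sets T}"
      by (simp add: sets_vimage_algebra)
  qed
  with indep have "indep_set (sets (vimage_algebra (space M) X S))
      (sets (vimage_algebra (space M) (\<lambda>\<omega>. f (Z \<omega>)) N))"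
    unfolding indep_sets2_eq by blast
  then show ?thesis
    using X measurable_compose[OF Z f] by (simp add: indep_var_eq sets_vimage_algebra)
qed

text \<open>Expectations of independent integrable variables multiply, so one centred factor is
  enough to kill the product.\<close>

lemma (in prob_space) indep_var_uncorrelated:
  fixes X Y :: "'a \<Rightarrow> real"
  assumes "indep_var borel X borel Y" "integrable M X" "integrable M Y" "expectation X = 0"
  shows "integrable M (\<lambda>\<omega>. X \<omega> * Y \<omega>)" "expectation (\<lambda>\<omega>. X \<omega> * Y \<omega>) = 0"
  using indep_var_integrable[OF assms(1-3)] indep_var_lebesgue_integral[OF assms(1-3)] assms(4)
  by auto

section \<open>First and second moments of the model\<close>

text \<open>The case split follows \<open>gaussian_rv\<close>: for \<open>s = 0\<close> everything
  is almost surely constant, otherwise the moments of the normal density apply. Afterwards zero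
  privacy noise needs no separate treatment.\<close>

lemma (in prob_space) gaussian_rv_moments:
  assumes "gaussian_rv M X m s" "s \<ge> 0"
  shows "X \<in> borel_measurable M"
    "integrable M X" "expectation X = m"
    "integrable M (\<lambda>\<omega>. (X \<omega> - m)\<^sup>2)" "expectation (\<lambda>\<omega>. (X \<omega> - m)\<^sup>2) = s\<^sup>2"
proof -
  have "X \<in> borel_measurable M \<and> integrable M X \<and> expectation X = m \<and>
    integrable M (\<lambda>\<omega>. (X \<omega> - m)\<^sup>2) \<and> expectation (\<lambda>\<omega>. (X \<omega> - m)\<^sup>2) = s\<^sup>2"
  proof (cases "s = 0")
    case True
    with assms have [measurable]: "X \<in> borel_measurable M" and X: "AE \<omega> in M. X \<omega> = m"
      by (auto simp: gaussian_rv_def)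
    have sq: "AE \<omega> in M. (X \<omega> - m)\<^sup>2 = 0"
      using X by eventually_elim simp
    have "integrable M X" "expectation X = m"
      using integrable_cong_AE[of X M "\<lambda>_. m"] integral_cong_AE[of X M "\<lambda>_. m"] X
      by (auto simp: prob_space)
    moreover have "integrable M (\<lambda>\<omega>. (X \<omega> - m)\<^sup>2)" "expectation (\<lambda>\<omega>. (X \<omega> - m)\<^sup>2) = 0"
      using integrable_cong_AE[of "\<lambda>\<omega>. (X \<omega> - m)\<^sup>2" M "\<lambda>_. 0"]
        integral_cong_AE[of "\<lambda>\<omega>. (X \<omega> - m)\<^sup>2" M "\<lambda>_. 0"] sq
      by auto
    ultimately show ?thesis
      using True by simp
  next
    case False
    with assms have s: "s > 0" and D: "distributed M lborel X (normal_density m s)"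
      by (auto simp: gaussian_rv_def)
    have "integrable M X"
      by (rule distributed_integrable_var[OF D normal_density_nonneg])
        (rule integrable_normal_moment_nz_1[OF s])
    moreover have "integrable M (\<lambda>\<omega>. (X \<omega> - m)\<^sup>2)"
      using distributed_integrable[OF D, of "\<lambda>x. (x - m)\<^sup>2"] integrable_normal_moment[OF s, of m 2]
      by simp
    ultimately show ?thesis
      using normal_distributed_expectation[OF s D] normal_distributed_variance[OF s D]
        distributed_measurable[OF D] by simp
  qed
  then show "X \<in> borel_measurable M" "integrable M X" "expectation X = m"
    "integrable M (\<lambda>\<omega>. (X \<omega> - m)\<^sup>2)" "expectation (\<lambda>\<omega>. (X \<omega> - m)\<^sup>2) = s\<^sup>2"
    by auto
qed

text \<open>The two noises enter flow and profit only through \<open>u + e\<close>. Its variance is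
  the sum of the two variances because \<open>u\<close> and \<open>e\<close> are uncorrelated, and
  it is uncorrelated with \<open>v\<close> because each summand is.\<close>

lemma (in prob_space) kyle_model_moments:
  assumes "kyle_model M v u e p0 sv su se"
  shows "v \<in> borel_measurable M" "u \<in> borel_measurable M" "e \<in> borel_measurable M"
    and "integrable M v" "expectation v = p0"
    and "integrable M (\<lambda>\<omega>. u \<omega> + e \<omega>)" "expectation (\<lambda>\<omega>. u \<omega> + e \<omega>) = 0"
    and "integrable M (\<lambda>\<omega>. (v \<omega> - p0)\<^sup>2)" "expectation (\<lambda>\<omega>. (v \<omega> - p0)\<^sup>2) = sv\<^sup>2"
    and "integrable M (\<lambda>\<omega>. (u \<omega> + e \<omega>)\<^sup>2)" "expectation (\<lambda>\<omega>. (u \<omega> + e \<omega>)\<^sup>2) = su\<^sup>2 + se\<^sup>2"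
    and "integrable M (\<lambda>\<omega>. (v \<omega> - p0) * (u \<omega> + e \<omega>))"
      "expectation (\<lambda>\<omega>. (v \<omega> - p0) * (u \<omega> + e \<omega>)) = 0"
proof -
  from assms have "sv \<ge> 0" "su \<ge> 0" "se \<ge> 0"
    and "gaussian_rv M v p0 sv" "gaussian_rv M u 0 su" "gaussian_rv M e 0 se"
    and uv: "indep_var borel u borel v"
    and evu: "indep_set (sets (vimage_algebra (space M) e borel))
       (sets (vimage_algebra (space M) (\<lambda>\<omega>. (v \<omega>, u \<omega>)) (borel \<Otimes>\<^sub>M borel)))"
    by (auto simp: kyle_model_def)
  then have V: "v \<in> borel_measurable M" "integrable M v" "expectation v = p0"
      "integrable M (\<lambda>\<omega>. (v \<omega> - p0)\<^sup>2)" "expectation (\<lambda>\<omega>. (v \<omega> - p0)\<^sup>2) = sv\<^sup>2"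
    and U: "u \<in> borel_measurable M" "integrable M u" "expectation u = 0"
      "integrable M (\<lambda>\<omega>. (u \<omega>)\<^sup>2)" "expectation (\<lambda>\<omega>. (u \<omega>)\<^sup>2) = su\<^sup>2"
    and E: "e \<in> borel_measurable M" "integrable M e" "expectation e = 0"
      "integrable M (\<lambda>\<omega>. (e \<omega>)\<^sup>2)" "expectation (\<lambda>\<omega>. (e \<omega>)\<^sup>2) = se\<^sup>2"
    using gaussian_rv_moments[of v p0 sv] gaussian_rv_moments[of u 0 su]
      gaussian_rv_moments[of e 0 se] by auto
  have pair: "(\<lambda>\<omega>. (v \<omega>, u \<omega>)) \<in> measurable M (borel \<Otimes>\<^sub>M borel)"
    using V(1) U(1) by (rule measurable_Pair)
  have ev: "indep_var borel e borel v" and eu: "indep_var borel e borel u"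
    using indep_var_compose_right_vimage[OF evu E(1) pair measurable_fst]
      indep_var_compose_right_vimage[OF evu E(1) pair measurable_snd] by simp_all
  \<comment> \<open>The centred variable has to come first, hence \<open>u\<close> and
    \<open>e\<close> precede \<open>v\<close>, whose mean \<open>p0\<close> may be nonzero.\<close>
  note UV = indep_var_uncorrelated[OF uv U(2) V(2) U(3)]
  note EV = indep_var_uncorrelated[OF ev E(2) V(2) E(3)]
  note EU = indep_var_uncorrelated[OF eu E(2) U(2) E(3)]
  show "v \<in> borel_measurable M" "u \<in> borel_measurable M" "e \<in> borel_measurable M"
    "integrable M v" "expectation v = p0"
    "integrable M (\<lambda>\<omega>. u \<omega> + e \<omega>)" "expectation (\<lambda>\<omega>. u \<omega> + e \<omega>) = 0"
    "integrable M (\<lambda>\<omega>. (v \<omega> - p0)\<^sup>2)" "expectation (\<lambda>\<omega>. (v \<omega> - p0)\<^sup>2) = sv\<^sup>2"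
    using U V E by simp_all
  have sq: "(\<lambda>\<omega>. (u \<omega> + e \<omega>)\<^sup>2) = (\<lambda>\<omega>. (u \<omega>)\<^sup>2 + (e \<omega>)\<^sup>2 + 2 * (e \<omega> * u \<omega>))"
    by (auto simp: power2_eq_square algebra_simps)
  show "integrable M (\<lambda>\<omega>. (u \<omega> + e \<omega>)\<^sup>2)"
    "expectation (\<lambda>\<omega>. (u \<omega> + e \<omega>)\<^sup>2) = su\<^sup>2 + se\<^sup>2"
    unfolding sq using U E EU by simp_all
  have pr: "(\<lambda>\<omega>. (v \<omega> - p0) * (u \<omega> + e \<omega>)) =
      (\<lambda>\<omega>. u \<omega> * v \<omega> + e \<omega> * v \<omega> - p0 * u \<omega> - p0 * e \<omega>)"
    by (auto simp: algebra_simps)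
  show "integrable M (\<lambda>\<omega>. (v \<omega> - p0) * (u \<omega> + e \<omega>))"
    "expectation (\<lambda>\<omega>. (v \<omega> - p0) * (u \<omega> + e \<omega>)) = 0"
    unfolding pr using U E UV EV by simp_all
qed

section \<open>Pricing condition\<close>

lemma (in prob_space) pricing_condition_moments:
  assumes kyle: "kyle_model M v u e p0 sv su se"
    and price: "AE \<omega> in M. p0 + l * noisy_flow (\<lambda>\<omega>. b * (v \<omega> - p0)) u e \<omega>
      = cond_exp_given M (noisy_flow (\<lambda>\<omega>. b * (v \<omega> - p0)) u e) v \<omega>"
  shows "l * (b\<^sup>2 * sv\<^sup>2 + (su\<^sup>2 + se\<^sup>2)) = b * sv\<^sup>2"
proof -
  note m = kyle_model_moments[OF kyle]
  note [measurable] = m(1-3)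
  define y where "y = noisy_flow (\<lambda>\<omega>. b * (v \<omega> - p0)) u e"
  let ?F = "vimage_algebra (space M) y borel"
  have y_eq: "y = (\<lambda>\<omega>. b * (v \<omega> - p0) + (u \<omega> + e \<omega>))"
    by (auto simp: y_def noisy_flow_def)
  have [measurable]: "y \<in> borel_measurable M"
    by (simp add: y_eq)
  interpret F: sigma_finite_subalgebra M ?F
    by (rule sigma_finite_subalgebra_vimage) measurable
  have yF: "y \<in> borel_measurable ?F"
    by (rule measurable_vimage_algebra1) auto
  have y1: "integrable M y" "expectation y = 0"
    unfolding y_eq using m by (simp_all add: prob_space)
  have sq: "(\<lambda>\<omega>. (y \<omega>)\<^sup>2) = (\<lambda>\<omega>. b\<^sup>2 * (v \<omega> - p0)\<^sup>2
      + 2 * b * ((v \<omega> - p0) * (u \<omega> + e \<omega>)) + (u \<omega> + e \<omega>)\<^sup>2)"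
    unfolding y_eq by (auto simp: power2_eq_square algebra_simps)
  have y2: "integrable M (\<lambda>\<omega>. (y \<omega>)\<^sup>2)"
      "expectation (\<lambda>\<omega>. (y \<omega>)\<^sup>2) = b\<^sup>2 * sv\<^sup>2 + (su\<^sup>2 + se\<^sup>2)"
    unfolding sq using m(8-13) by simp_all
  \<comment> \<open>Splitting off \<open>p0 * y\<close>, which has mean zero, leaves the covariance
    of flow and value.\<close>
  have pr: "(\<lambda>\<omega>. y \<omega> * v \<omega>) =
      (\<lambda>\<omega>. b * (v \<omega> - p0)\<^sup>2 + (v \<omega> - p0) * (u \<omega> + e \<omega>) + p0 * y \<omega>)"
    unfolding y_eq by (auto simp: power2_eq_square algebra_simps)
  have yv: "integrable M (\<lambda>\<omega>. y \<omega> * v \<omega>)" "expectation (\<lambda>\<omega>. y \<omega> * v \<omega>) = b * sv\<^sup>2"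
    unfolding pr using m(8-13) y1 by simp_all
  \<comment> \<open>The flow is measurable for the sigma-algebra it generates, so it is an
    admissible test function and the conditional expectation of \<open>v\<close> may replace
    \<open>v\<close>. The pricing condition then turns that into an affine function of the
    flow.\<close>
  have "b * sv\<^sup>2 = expectation (\<lambda>\<omega>. y \<omega> * real_cond_exp M ?F v \<omega>)"
    using F.real_cond_exp_intg(2)[OF yv(1) yF] yv(2) by simp
  also have "\<dots> = expectation (\<lambda>\<omega>. y \<omega> * (p0 + l * y \<omega>))"
    using price[folded y_def, unfolded cond_exp_given_def] by (intro integral_cong_AE) auto
  also have "\<dots> = expectation (\<lambda>\<omega>. p0 * y \<omega> + l * (y \<omega>)\<^sup>2)"
    by (simp add: power2_eq_square algebra_simps)
  also have "\<dots> = l * (b\<^sup>2 * sv\<^sup>2 + (su\<^sup>2 + se\<^sup>2))"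
    using y1 y2 by simp
  finally show ?thesis by simp
qed

section \<open>Optimality condition\<close>

text \<open>By continuity the bound extends from the rationals to the reals, and at the vertex of
  the parabola it forces \<open>x\<close> to be that vertex. Rational competitors are what an almost
  sure statement can supply: each order brings its own exceptional null set, and only countably many
  may be united.\<close>

lemma quadratic_argmax_of_rational_bound:
  fixes h l x :: real
  assumes "l > 0" and le: "\<And>y. y \<in> \<rat> \<Longrightarrow> h * y - l * y\<^sup>2 \<le> h * x - l * x\<^sup>2"
  shows "h = 2 * l * x"
proof -
  have "closed {y. h * y - l * y\<^sup>2 \<le> h * x - l * x\<^sup>2}"
    by (intro closed_Collect_le continuous_intros)
  moreover have "\<rat> \<subseteq> {y. h * y - l * y\<^sup>2 \<le> h * x - l * x\<^sup>2}"
    using le by auto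
  ultimately have "closure \<rat> \<subseteq> {y. h * y - l * y\<^sup>2 \<le> h * x - l * x\<^sup>2}"
    by (rule closure_minimal[rotated])
  \<comment> \<open>The vertex is \<open>h / (2 * l)\<close>; the gap between the values there and
    at \<open>x\<close> is a positive multiple of the square of
    \<open>h - 2 * l * x\<close>.\<close>
  then have "h * (h / (2 * l)) - l * (h / (2 * l))\<^sup>2 \<le> h * x - l * x\<^sup>2"
    using Rats_closure_real by blast
  then have "(h - 2 * l * x)\<^sup>2 \<le> 0"
    using \<open>l > 0\<close> by (simp add: field_simps power2_eq_square)
  then show ?thesis by simp
qed

lemma (in prob_space) optimality_condition_moments:
  assumes kyle: "kyle_model M v u e p0 sv su se" and "l > 0"
    and opt: "\<And>y::real. AE \<omega> in M. cond_exp_given M v (profit v u e p0 l (\<lambda>_. y)) \<omega>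
      \<le> cond_exp_given M v (profit v u e p0 l (\<lambda>\<omega>. b * (v \<omega> - p0))) \<omega>"
  shows "l * b = 1 / 2"
proof -
  note m = kyle_model_moments[OF kyle]
  note [measurable] = m(1-3)
  let ?F = "vimage_algebra (space M) v borel"
  let ?W = "\<lambda>\<omega>. v \<omega> - p0"
  let ?N = "\<lambda>\<omega>. u \<omega> + e \<omega>"
  let ?g = "real_cond_exp M ?F ?N"
  interpret F: sigma_finite_subalgebra M ?F
    by (rule sigma_finite_subalgebra_vimage) measurable
  have [measurable]: "v \<in> borel_measurable ?F"
    by (rule measurable_vimage_algebra1) auto
  \<comment> \<open>Stated for every order measurable in \<open>v\<close>, so that it covers both
    the constant competitors and the linear strategy.\<close>
  have profit: "AE \<omega> in M. cond_exp_given M v (profit v u e p0 l x) \<omega>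
      = (?W \<omega> - l * ?g \<omega>) * x \<omega> - l * (x \<omega>)\<^sup>2"
    if [measurable]: "x \<in> borel_measurable ?F"
      and int: "integrable M (\<lambda>\<omega>. ?W \<omega> * x \<omega>)" "integrable M (\<lambda>\<omega>. (x \<omega>)\<^sup>2)"
        "integrable M (\<lambda>\<omega>. x \<omega> * ?N \<omega>)" for x
  proof -
    \<comment> \<open>\<open>A\<close> is known given \<open>v\<close> and equals its own
      conditional expectation; \<open>B\<close> carries the noise, and the factor \<open>x\<close>
      can be pulled out of its conditional expectation.\<close>
    define A where "A = (\<lambda>\<omega>. ?W \<omega> * x \<omega> - l * (x \<omega>)\<^sup>2)"
    define B where "B = (\<lambda>\<omega>. x \<omega> * ?N \<omega>)"
    have p: "profit v u e p0 l x = (\<lambda>\<omega>. A \<omega> - l * B \<omega>)"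
      by (auto simp: profit_def noisy_flow_def A_def B_def power2_eq_square algebra_simps)
    have A: "integrable M A" "A \<in> borel_measurable ?F" and B: "integrable M B"
      unfolding A_def B_def using int by auto
    have "AE \<omega> in M. real_cond_exp M ?F (\<lambda>\<omega>. A \<omega> - l * B \<omega>) \<omega>
        = real_cond_exp M ?F A \<omega> - real_cond_exp M ?F (\<lambda>\<omega>. l * B \<omega>) \<omega>"
      using A B by (intro F.real_cond_exp_diff) auto
    moreover have "AE \<omega> in M. real_cond_exp M ?F (\<lambda>\<omega>. l * B \<omega>) \<omega> = l * real_cond_exp M ?F B \<omega>"
      by (rule F.real_cond_exp_cmult[OF B])
    moreover have "AE \<omega> in M. real_cond_exp M ?F A \<omega> = A \<omega>"
      by (rule F.real_cond_exp_F_meas[OF A])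
    moreover have "AE \<omega> in M. real_cond_exp M ?F B \<omega> = x \<omega> * ?g \<omega>"
      unfolding B_def using int(3) by (intro F.real_cond_exp_mult) auto
    ultimately show ?thesis
      unfolding cond_exp_given_def p by eventually_elim (simp add: A_def algebra_simps)
  qed
  have best: "AE \<omega> in M. cond_exp_given M v (profit v u e p0 l (\<lambda>\<omega>. b * ?W \<omega>)) \<omega>
      = (?W \<omega> - l * ?g \<omega>) * (b * ?W \<omega>) - l * (b * ?W \<omega>)\<^sup>2"
  proof (rule profit)
    show "integrable M (\<lambda>\<omega>. ?W \<omega> * (b * ?W \<omega>))"
      using integrable_mult_right[OF m(8), of b] by (simp add: power2_eq_square ac_simps)
    show "integrable M (\<lambda>\<omega>. (b * ?W \<omega>)\<^sup>2)"
      using m(8) by (simp add: power_mult_distrib)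
    show "integrable M (\<lambda>\<omega>. b * ?W \<omega> * ?N \<omega>)"
      using integrable_mult_right[OF m(12), of b] by (simp add: ac_simps)
  qed measurable
  have ineq: "AE \<omega> in M. (?W \<omega> - l * ?g \<omega>) * y - l * y\<^sup>2
      \<le> (?W \<omega> - l * ?g \<omega>) * (b * ?W \<omega>) - l * (b * ?W \<omega>)\<^sup>2" for y
  proof -
    have "AE \<omega> in M. cond_exp_given M v (profit v u e p0 l (\<lambda>_. y)) \<omega>
        = (?W \<omega> - l * ?g \<omega>) * y - l * y\<^sup>2"
      using m(4,6) by (intro profit) auto
    with opt[of y] best show ?thesis
      by eventually_elim simp
  qed
  \<comment> \<open>Countability of the rationals lets the quantifier move inside the almost sure
    statement.\<close>
  have "AE \<omega> in M. \<forall>y\<in>\<rat>. (?W \<omega> - l * ?g \<omega>) * y - l * y\<^sup>2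
      \<le> (?W \<omega> - l * ?g \<omega>) * (b * ?W \<omega>) - l * (b * ?W \<omega>)\<^sup>2"
    using ineq by (intro AE_ball_countable') (auto simp: countable_rat)
  then have foc: "AE \<omega> in M. ?W \<omega> - l * ?g \<omega> = 2 * l * (b * ?W \<omega>)"
    by eventually_elim (rule quadratic_argmax_of_rational_bound[OF \<open>l > 0\<close>], blast)
  \<comment> \<open>\<open>?W\<close> is measurable in \<open>v\<close>, so \<open>?g\<close> can be
    replaced by \<open>?N\<close> under the integral. This moment is all that is used of
    \<open>?g\<close>, which is never computed.\<close>
  have "expectation (\<lambda>\<omega>. ?W \<omega> * ?g \<omega>) = 0"
    using F.real_cond_exp_intg(2)[OF m(12)] m(13) by simp
  moreover have "expectation (\<lambda>\<omega>. l * (?W \<omega> * ?g \<omega>))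
      = expectation (\<lambda>\<omega>. (1 - 2 * l * b) * (?W \<omega>)\<^sup>2)"
  proof (rule integral_cong_AE)
    show "AE \<omega> in M. l * (?W \<omega> * ?g \<omega>) = (1 - 2 * l * b) * (?W \<omega>)\<^sup>2"
      using foc
    proof eventually_elim
      case (elim \<omega>)
      then have "l * ?g \<omega> = (1 - 2 * l * b) * ?W \<omega>"
        by (simp add: algebra_simps)
      then have "?W \<omega> * (l * ?g \<omega>) = ?W \<omega> * ((1 - 2 * l * b) * ?W \<omega>)"
        by (rule arg_cong)
      then show ?case by (simp only: power2_eq_square ac_simps)
    qed
  qed measurable
  ultimately have "(1 - 2 * l * b) * sv\<^sup>2 = 0"
    using m(9) by simp
  moreover have "sv > 0"
    using kyle by (simp add: kyle_model_def)
  ultimately show ?thesis by simp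
qed

section \<open>Closed form of the equilibrium and comparative statics\<close>

lemma linear_equilibrium_coefficients:
  assumes kyle: "kyle_model M v u e p0 sv su se"
    and eq: "linear_equilibrium M v u e p0 b l"
  shows "b = sqrt (su\<^sup>2 + se\<^sup>2) / sv" "l = sv / (2 * sqrt (su\<^sup>2 + se\<^sup>2))"
proof -
  interpret prob_space M
    using kyle by (simp add: kyle_model_def)
  have pos: "b > 0" "l > 0" "sv > 0" "su > 0"
    using kyle eq by (auto simp: kyle_model_def linear_equilibrium_def)
  have price: "l * (b\<^sup>2 * sv\<^sup>2 + (su\<^sup>2 + se\<^sup>2)) = b * sv\<^sup>2"
    using eq by (intro pricing_condition_moments[OF kyle]) (simp add: linear_equilibrium_def Let_def)
  have half: "l * b = 1 / 2"
    using eq by (intro optimality_condition_moments[OF kyle])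
      (simp_all add: linear_equilibrium_def Let_def)
  \<comment> \<open>Multiplied by \<open>b\<close>, the pricing equation contains \<open>l\<close>
    only in the product \<open>l * b\<close>, which is \<open>1 / 2\<close>. What remains determines
    the square of \<open>b * sv\<close>, and positivity selects the root.\<close>
  have "1 / 2 * (b\<^sup>2 * sv\<^sup>2 + (su\<^sup>2 + se\<^sup>2)) = b * (b * sv\<^sup>2)"
    using arg_cong[OF price, of "\<lambda>t. b * t"] unfolding half[symmetric] by (simp only: ac_simps)
  then have "su\<^sup>2 + se\<^sup>2 = (b * sv)\<^sup>2"
    by (simp add: power2_eq_square algebra_simps)
  then have "sqrt (su\<^sup>2 + se\<^sup>2) = b * sv"
    using pos by simp
  with half pos show "b = sqrt (su\<^sup>2 + se\<^sup>2) / sv" "l = sv / (2 * sqrt (su\<^sup>2 + se\<^sup>2))"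
    by (simp_all add: field_simps)
qed

text \<open>Each noise level \<open>s\<close> may have its own probability space. Derivatives are
  signed for \<open>s > 0\<close>: the one-sided derivatives of both closed forms vanish at 0.
  Strict monotonicity on \<open>{0..}\<close> includes the endpoint.\<close>

theorem proposition1:
  fixes p0 sv su :: real
    and M :: "real \<Rightarrow> 'a measure"
    and v u e :: "real \<Rightarrow> 'a \<Rightarrow> real"
    and \<beta> \<Lambda> :: "real \<Rightarrow> real"
  assumes "sv > 0" and "su > 0"
    and "\<And>s. s \<ge> 0 \<Longrightarrow> kyle_model (M s) (v s) (u s) (e s) p0 sv su s"
    and "\<And>s. s \<ge> 0 \<Longrightarrow> linear_equilibrium (M s) (v s) (u s) (e s) p0 (\<beta> s) (\<Lambda> s)"
  shows "((\<forall>s>0. \<exists>D. (\<Lambda> has_real_derivative D) (at s) \<and> D < 0) \<and> strict_antimono_on {0..} \<Lambda>)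
       \<and> ((\<forall>s>0. \<exists>D. (\<beta> has_real_derivative D) (at s) \<and> D > 0) \<and> strict_mono_on {0..} \<beta>)
       \<and> (\<forall>s\<ge>0. \<Lambda> s * \<beta> s = 1 / 2)"
proof -
  have b: "\<beta> s = sqrt (su\<^sup>2 + s\<^sup>2) / sv" and l: "\<Lambda> s = sv / (2 * sqrt (su\<^sup>2 + s\<^sup>2))"
    if "s \<ge> 0" for s
    using linear_equilibrium_coefficients[OF assms(3,4)] that by blast+
  have pos: "su\<^sup>2 + s\<^sup>2 > 0" for s
    using \<open>su > 0\<close> by (simp add: add_pos_nonneg)
  have root_mono: "sqrt (su\<^sup>2 + s\<^sup>2) < sqrt (su\<^sup>2 + t\<^sup>2)" if "0 \<le> s" "s < t" for s t
    using that by (simp add: power_strict_mono)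
  have root_deriv: "((\<lambda>s. sqrt (su\<^sup>2 + s\<^sup>2)) has_real_derivative s / sqrt (su\<^sup>2 + s\<^sup>2)) (at s)" for s
    using pos[of s] by (auto intro!: derivative_eq_intros simp: field_simps)
  have "\<exists>D. (\<Lambda> has_real_derivative D) (at s) \<and> D < 0" if "s > 0" for s
  proof (intro exI conjI)
    \<comment> \<open>Quotient rule for \<open>sv / (2 * r)\<close>, with \<open>r\<close> the
      square root and derivative of \<open>r\<close> equal to \<open>s / r\<close>.\<close>
    let ?D = "- (sv * (s / sqrt (su\<^sup>2 + s\<^sup>2)) / (2 * (sqrt (su\<^sup>2 + s\<^sup>2))\<^sup>2))"
    have "((\<lambda>s. sv / (2 * sqrt (su\<^sup>2 + s\<^sup>2))) has_real_derivative ?D) (at s)"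
      using pos[of s] by (auto intro!: derivative_eq_intros root_deriv simp: divide_simps power2_eq_square)
    \<comment> \<open>The closed form of \<open>\<Lambda>\<close> is known only for nonnegative
      arguments, so the derivative is transferred on the open half-line around
      \<open>s\<close>.\<close>
    then show "(\<Lambda> has_real_derivative ?D) (at s)"
      by (rule has_field_derivative_transform_within_open[where S = "{0<..}"]) (use that l in auto)
    show "?D < 0"
      using that pos[of s] \<open>sv > 0\<close> by simp
  qed
  moreover have "\<exists>D. (\<beta> has_real_derivative D) (at s) \<and> D > 0" if "s > 0" for s
  proof (intro exI conjI)
    let ?D = "s / sqrt (su\<^sup>2 + s\<^sup>2) / sv"
    have "((\<lambda>s. sqrt (su\<^sup>2 + s\<^sup>2) / sv) has_real_derivative ?D) (at s)"
      by (intro DERIV_cdivide root_deriv)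
    then show "(\<beta> has_real_derivative ?D) (at s)"
      by (rule has_field_derivative_transform_within_open[where S = "{0<..}"]) (use that b in auto)
    show "?D > 0"
      using that pos[of s] \<open>sv > 0\<close> by simp
  qed
  moreover have "strict_antimono_on {0..} \<Lambda>"
  proof (rule monotone_onI)
    fix s t :: real assume "s \<in> {0..}" "t \<in> {0..}" "s < t"
    then show "\<Lambda> s > \<Lambda> t"
      using root_mono[of s t] pos[of s] pos[of t] \<open>sv > 0\<close>
      by (simp add: l divide_strict_left_mono)
  qed
  moreover have "strict_mono_on {0..} \<beta>"
  proof (rule monotone_onI)
    fix s t :: real assume "s \<in> {0..}" "t \<in> {0..}" "s < t"
    then show "\<beta> s < \<beta> t"
      using root_mono[of s t] \<open>sv > 0\<close> by (simp add: b divide_strict_right_mono)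
  qed
  moreover have "\<Lambda> s * \<beta> s = 1 / 2" if "s \<ge> 0" for s
    using that \<open>su > 0\<close> \<open>sv > 0\<close> by (simp add: b l)
  ultimately show ?thesis by blast
qed

end
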